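(* Let $Y$ and $Z$ be real Banach spaces, $\Omega$ a nonempty open subset of $Z$, $k\in\mathbb N$, and let $M$ be a nonempty bounded subset of $\mathcal{BC}^k(\Omega,Y)$. Then $$\max\left\{\mu_{\overline\alpha}(M),\ \tfrac12\,\omega_{\mathcal{BC}^k}(M)\right\}\le\alpha(M)\le\mu_{\overline\alpha}(M)+2\,\omega_{\mathcal{BC}^k}(M).$$
   Context: Differentiability is in the Fréchet sense. $\mathcal C^k(\Omega,Y)$ is the space of $k$-times continuously differentiable functions $f:\Omega\to Y$; for $p=0,\dots,k$, $d^pf:\Omega\to W_p$ is the differential of order $p$, where $W_p=\mathcal L(Z^p,Y)$ is the Banach space of bounded $p$-linear operators with the operator norm $\|\cdot\|_{on}$ ($W_0=Y$, $d^0f=f$). $\mathcal{BC}^k(\Omega,Y)$ is the Banach space of all $f\in\mathcal C^k(\Omega,Y)$ which are bounded together with all differentials up to order $k$, with norm $\|f\|_{\mathcal{BC}^k}=\max\{\|f\|_\infty,\|df\|_\infty,\dots,\|d^kf\|_\infty\}$, $\|d^pf\|_\infty=\sup_{x\in\Omega}\|d^pf(x)\|_{on}$. For a nonempty bounded subset of a Banach space, the Kuratowski measure of noncompactness is the infimum of all $\varepsilon>0$ such that the set can be covered by finitely many sets of diameter not greater than $\varepsilon$. $\alpha(M)$ denotes the Kuratowski measure of $M$ in $\mathcal{BC}^k(\Omega,Y)$ and $\alpha_p$ the Kuratowski measure in $W_p$. For $M\subseteq\mathcal{BC}^k(\Omega,Y)$ bounded and $x\in\Omega$, $M^p(x)=\{d^pf(x):f\in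 M\}\subseteq W_p$, and $\mu_{\overline\alpha}(M)=\max_{0\le p\le k}\ \sup_{x\in\Omega}\alpha_p(M^p(x))$. $\omega_{\mathcal{BC}^k}(M)$ is the infimum of all $\varepsilon>0$ for which there are a finite partition $\{A_1,\dots,A_n\}$ of $\Omega$ and a finite set $\{\varphi_1,\dots,\varphi_m\}\subseteq\mathcal{BC}^k(\Omega,Y)$ such that for every $f\in M$ there is $j\in\{1,\dots,m\}$ with $\max_{0\le p\le k}\operatorname{diam}_{W_p}\big((d^p(f-\varphi_j))(A_i)\big)\le\varepsilon$ for all $i=1,\dots,n$. *)

theory Defs
  imports "HOL-Analysis.Analysis"
begin

section \<open>Bounded multilinear operators of arbitrary order\<close>

text \<open>The order \<open>p\<close> of the spaces \<open>W\<^sub>p = L(Z\<^sup>p, Y)\<close> varies inside the statement, so they cannot be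
  separate types. An element \<open>T\<close> of the type below is a function on lists whose restriction to the
  lists of length \<open>p\<close>, that is to \<open>Z\<^sup>p\<close>, is \<open>p\<close>-linear for every \<open>p\<close>, the operator norms of these
  restrictions being uniformly bounded. The space \<open>W\<^sub>p\<close> is the subspace \<open>W p\<close> of those \<open>T\<close> that
  live on lists of length \<open>p\<close> only; there the norm is the usual operator norm (\<open>norm_W\<close>).\<close>

typedef (overloaded) ('a, 'b) mlin =
  "{T :: 'a::real_normed_vector list \<Rightarrow> 'b::real_normed_vector.
      (\<forall>xs ys. linear (\<lambda>h. T (xs @ h # ys))) \<and>
      bdd_above ((\<lambda>xs. norm (T xs)) ` {xs. \<forall>x\<in>set xs. norm x \<le> 1})}"
  morphisms mapply Mlin
  by (rule exI[of _ "\<lambda>_. 0"]) (auto simp: linear_iff bdd_above_def)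

setup_lifting type_definition_mlin

lemma mlin_eqI: "(\<And>xs. mapply S xs = mapply T xs) \<Longrightarrow> S = T"
  by transfer auto

lemma linear_mapply: "linear (\<lambda>h. mapply T (xs @ h # ys))"
  using mapply[of T] by simp

lemma bdd_above_mapply:
  "bdd_above ((\<lambda>xs. norm (mapply T xs)) ` {xs. \<forall>x\<in>set xs. norm x \<le> 1})"
  using mapply[of T] by simp

lemma mlin_memI:
  assumes "\<And>xs ys. linear (\<lambda>h. T (xs @ h # ys))"
    and "\<And>xs. (\<And>x. x \<in> set xs \<Longrightarrow> norm x \<le> 1) \<Longrightarrow> norm (T xs) \<le> C"
  shows "(\<forall>xs ys. linear (\<lambda>h. T (xs @ h # ys))) \<and>
      bdd_above ((\<lambda>xs. norm (T xs)) ` {xs. \<forall>x\<in>set xs. norm x \<le> (1::real)})"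
  using assms by (auto intro!: bdd_aboveI2[where M = C])

instantiation mlin :: (real_normed_vector, real_normed_vector) real_normed_vector
begin

lift_definition norm_mlin :: "('a, 'b) mlin \<Rightarrow> real" is
  "\<lambda>T. SUP xs\<in>{xs. \<forall>x\<in>set xs. norm x \<le> 1}. norm (T xs)" .

lift_definition zero_mlin :: "('a, 'b) mlin" is "\<lambda>_. 0"
  by (auto simp: linear_iff bdd_above_def)

lift_definition plus_mlin :: "('a, 'b) mlin \<Rightarrow> ('a, 'b) mlin \<Rightarrow> ('a, 'b) mlin"
  is "\<lambda>S T xs. S xs + T xs"
proof -
  fix S T :: "'a list \<Rightarrow> 'b"
  assume S: "(\<forall>xs ys. linear (\<lambda>h. S (xs @ h # ys))) \<and>
      bdd_above ((\<lambda>xs. norm (S xs)) ` {xs. \<forall>x\<in>set xs. norm x \<le> 1})"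
    and T: "(\<forall>xs ys. linear (\<lambda>h. T (xs @ h # ys))) \<and>
      bdd_above ((\<lambda>xs. norm (T xs)) ` {xs. \<forall>x\<in>set xs. norm x \<le> 1})"
  from S obtain a where "\<And>xs. (\<forall>x\<in>set xs. norm x \<le> 1) \<Longrightarrow> norm (S xs) \<le> a"
    by (fastforce elim: bdd_above.E)
  moreover from T obtain b where "\<And>xs. (\<forall>x\<in>set xs. norm x \<le> 1) \<Longrightarrow> norm (T xs) \<le> b"
    by (fastforce elim: bdd_above.E)
  ultimately show "(\<forall>xs ys. linear (\<lambda>h. S (xs @ h # ys) + T (xs @ h # ys))) \<and>
      bdd_above ((\<lambda>xs. norm (S xs + T xs)) ` {xs. \<forall>x\<in>set xs. norm x \<le> 1})"
    using S T by (intro mlin_memI[where C = "a + b"]) (auto intro!: linear_compose_add norm_triangle_mono)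
qed

lift_definition scaleR_mlin :: "real \<Rightarrow> ('a, 'b) mlin \<Rightarrow> ('a, 'b) mlin"
  is "\<lambda>r T xs. r *\<^sub>R T xs"
proof -
  fix r :: real and T :: "'a list \<Rightarrow> 'b"
  assume T: "(\<forall>xs ys. linear (\<lambda>h. T (xs @ h # ys))) \<and>
      bdd_above ((\<lambda>xs. norm (T xs)) ` {xs. \<forall>x\<in>set xs. norm x \<le> 1})"
  then obtain b where "\<And>xs. (\<forall>x\<in>set xs. norm x \<le> 1) \<Longrightarrow> norm (T xs) \<le> b"
    by (fastforce elim: bdd_above.E)
  with T show "(\<forall>xs ys. linear (\<lambda>h. r *\<^sub>R T (xs @ h # ys))) \<and>
      bdd_above ((\<lambda>xs. norm (r *\<^sub>R T xs)) ` {xs. \<forall>x\<in>set xs. norm x \<le> 1})"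
    by (intro mlin_memI[where C = "\<bar>r\<bar> * b"])
      (auto intro!: linear_compose_scale_right mult_left_mono)
qed

definition uminus_mlin :: "('a, 'b) mlin \<Rightarrow> ('a, 'b) mlin"
  where "uminus_mlin T = (- 1) *\<^sub>R T"

definition minus_mlin :: "('a, 'b) mlin \<Rightarrow> ('a, 'b) mlin \<Rightarrow> ('a, 'b) mlin"
  where "minus_mlin S T = S + (- 1) *\<^sub>R T"

definition dist_mlin :: "('a, 'b) mlin \<Rightarrow> ('a, 'b) mlin \<Rightarrow> real"
  where "dist_mlin S T = norm (S - T)"

definition [code del]:
  "(uniformity :: (('a, 'b) mlin \<times> ('a, 'b) mlin) filter) =
    (INF e\<in>{0 <..}. principal {(S, T). dist S T < e})"

definition open_mlin :: "('a, 'b) mlin set \<Rightarrow> bool"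
  where [code del]: "open_mlin U = (\<forall>S\<in>U. \<forall>\<^sub>F (S', T) in uniformity. S' = S \<longrightarrow> T \<in> U)"

definition sgn_mlin :: "('a, 'b) mlin \<Rightarrow> ('a, 'b) mlin"
  where "sgn_mlin T = scaleR (inverse (norm T)) T"

lemma norm_mapply_le_unit:
  assumes "\<And>x. x \<in> set xs \<Longrightarrow> norm x \<le> 1"
  shows "norm (mapply T xs) \<le> norm (T :: ('a, 'b) mlin)"
  using assms by (simp add: norm_mlin.rep_eq) (intro cSUP_upper2[OF bdd_above_mapply], auto)

lemma norm_mlin_le:
  assumes "\<And>xs. (\<And>x. x \<in> set xs \<Longrightarrow> norm x \<le> 1) \<Longrightarrow> norm (mapply T xs) \<le> C"
  shows "norm (T :: ('a, 'b) mlin) \<le> C"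
proof -
  have "[] \<in> {xs :: 'a list. \<forall>x\<in>set xs. norm x \<le> 1}" by simp
  then show ?thesis
    unfolding norm_mlin.rep_eq by (intro cSUP_least) (blast, use assms in blast)
qed

lemma mapply_scale:
  "mapply T (ys @ map (\<lambda>x. c x *\<^sub>R u x) xs) =
    prod_list (map c xs) *\<^sub>R mapply T (ys @ map u xs)"
proof (induction xs arbitrary: ys)
  case (Cons x xs)
  have "mapply T (ys @ map (\<lambda>x. c x *\<^sub>R u x) (x # xs)) =
      c x *\<^sub>R mapply T (ys @ u x # map (\<lambda>x. c x *\<^sub>R u x) xs)"
    using linear_scale[OF linear_mapply[of T ys "map (\<lambda>x. c x *\<^sub>R u x) xs"], of "c x" "u x"]
    by simp
  also have "\<dots> = prod_list (map c (x # xs)) *\<^sub>R mapply T (ys @ map u (x # xs))"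
    using Cons.IH[of "ys @ [u x]"] by simp
  finally show ?case .
qed simp

lemma norm_mapply:
  "norm (mapply T xs) \<le> norm (T :: ('a, 'b) mlin) * prod_list (map norm xs)"
proof -
  have "map (\<lambda>x. norm x *\<^sub>R sgn x) xs = xs"
  proof (rule map_idI)
    show "norm x *\<^sub>R sgn x = x" for x :: 'a
      by (cases "x = 0") (simp_all add: sgn_div_norm)
  qed
  then have "mapply T xs = prod_list (map norm xs) *\<^sub>R mapply T (map sgn xs)"
    using mapply_scale[of T "[]" norm sgn xs] by simp
  moreover have "norm (mapply T (map sgn xs)) \<le> norm T"
    by (rule norm_mapply_le_unit) (auto simp: norm_sgn)
  moreover have "0 \<le> prod_list (map norm xs)"
    by (induction xs) auto
  ultimately show ?thesis
    by (simp add: mult.commute[of "norm T"] mult_left_mono)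
qed

instance
proof
  fix S T U :: "('a, 'b) mlin" and r s :: real
  show "dist S T = norm (S - T)" by (rule dist_mlin_def)
  show "sgn T = inverse (norm T) *\<^sub>R T" by (rule sgn_mlin_def)
  show "(uniformity :: (('a, 'b) mlin \<times> ('a, 'b) mlin) filter) =
    (INF e\<in>{0 <..}. principal {(S, T). dist S T < e})" by (rule uniformity_mlin_def)
  show "open V = (\<forall>S\<in>V. \<forall>\<^sub>F (S', T) in uniformity. S' = S \<longrightarrow> T \<in> V)"
    for V :: "('a, 'b) mlin set" by (rule open_mlin_def)
  show "S + T + U = S + (T + U)" by transfer (simp add: ac_simps)
  show "S + T = T + S" by transfer (simp add: ac_simps)
  show "0 + T = T" by transfer simp
  show "- T + T = 0" unfolding uminus_mlin_def by transfer simp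
  show "S - T = S + - T" unfolding uminus_mlin_def minus_mlin_def ..
  show "r *\<^sub>R (S + T) = r *\<^sub>R S + r *\<^sub>R T" by transfer (simp add: algebra_simps)
  show "(r + s) *\<^sub>R T = r *\<^sub>R T + s *\<^sub>R T" by transfer (simp add: algebra_simps)
  show "r *\<^sub>R s *\<^sub>R T = (r * s) *\<^sub>R T" by transfer simp
  show "1 *\<^sub>R T = T" by transfer simp
  show "(norm T = 0) = (T = 0)"
  proof
    assume "norm T = 0"
    then have "mapply T xs = mapply 0 xs" for xs
      using norm_mapply[of T xs] by (simp add: zero_mlin.rep_eq)
    then show "T = 0" by (rule mlin_eqI)
  next
    assume "T = 0"
    then have "norm T \<le> 0" by (intro norm_mlin_le) (simp add: zero_mlin.rep_eq)
    moreover have "0 \<le> norm T"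
      using norm_mapply_le_unit[of "[]" T] norm_ge_zero[of "mapply T []"]
      by (simp del: norm_ge_zero)
    ultimately show "norm T = 0" by simp
  qed
  show "norm (S + T) \<le> norm S + norm T"
    by (rule norm_mlin_le)
      (auto simp: plus_mlin.rep_eq intro!: norm_triangle_mono norm_mapply_le_unit)
  show "norm (r *\<^sub>R T) = \<bar>r\<bar> * norm T"
  proof (rule antisym)
    have le: "norm (r *\<^sub>R T) \<le> \<bar>r\<bar> * norm T" for r and T :: "('a, 'b) mlin"
      by (rule norm_mlin_le)
        (auto simp: scaleR_mlin.rep_eq intro!: mult_left_mono norm_mapply_le_unit)
    show "norm (r *\<^sub>R T) \<le> \<bar>r\<bar> * norm T" by (rule le)
    have nn: "0 \<le> norm (r *\<^sub>R T)"
      using norm_mapply_le_unit[of "[]" "r *\<^sub>R T"] norm_ge_zero[of "mapply (r *\<^sub>R T) []"]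
      by (simp del: norm_ge_zero)
    show "\<bar>r\<bar> * norm T \<le> norm (r *\<^sub>R T)"
    proof (cases "r = 0")
      case False
      then have "inverse r *\<^sub>R r *\<^sub>R T = T" by transfer simp
      then show ?thesis
        using le[of "inverse r" "r *\<^sub>R T"] False by (simp add: field_simps abs_inverse)
    qed (use nn in simp)
  qed
qed

end

lemma mapply_minus: "mapply (S - T) xs = mapply S xs - mapply T xs"
  unfolding minus_mlin_def plus_mlin.rep_eq scaleR_mlin.rep_eq by simp

lemma bounded_linear_mapply: "bounded_linear (\<lambda>T. mapply T xs)"
  by (rule bounded_linear_intro[where K = "prod_list (map norm xs)"])
    (auto simp: plus_mlin.rep_eq scaleR_mlin.rep_eq norm_mapply)

definition W :: "nat \<Rightarrow> ('a::real_normed_vector, 'b::real_normed_vector) mlin set"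
  where "W p = {T. \<forall>xs. length xs \<noteq> p \<longrightarrow> mapply T xs = 0}"

lemma norm_W:
  assumes "T \<in> W p"
  shows "norm T = (SUP xs\<in>{xs. length xs = p \<and> (\<forall>x\<in>set xs. norm x \<le> 1)}. norm (mapply T xs))"
    (is "_ = Sup (?f ` ?B)")
proof (rule antisym)
  have ne: "?B \<noteq> {}"
    by (auto intro: exI[of _ "replicate p 0"])
  have bdd: "bdd_above (?f ` ?B)"
    by (rule bdd_above_mono[OF bdd_above_mapply[of T]]) auto
  obtain xs0 where "xs0 \<in> ?B" using ne by blast
  then have "0 \<le> Sup (?f ` ?B)"
    using bdd by (meson cSUP_upper2 norm_ge_zero)
  then show "norm T \<le> Sup (?f ` ?B)"
  proof (intro norm_mlin_le)
    fix xs :: "'a list"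
    assume "\<And>x. x \<in> set xs \<Longrightarrow> norm x \<le> 1"
    then have "length xs = p \<Longrightarrow> xs \<in> ?B" by simp
    then show "norm (mapply T xs) \<le> Sup (?f ` ?B)"
      using assms \<open>0 \<le> _\<close> cSUP_upper[OF _ bdd, of xs]
      by (cases "length xs = p") (simp_all add: W_def)
  qed
  show "Sup (?f ` ?B) \<le> norm T"
    using ne by (intro cSUP_least norm_mapply_le_unit) auto
qed


section \<open>Higher Frechet differentials and the space \<open>BC\<^sup>k\<close>\<close>

text \<open>The identification of \<open>W\<^sub>0\<close> with the target space.\<close>

lift_definition mconst ::
    "'b::real_normed_vector \<Rightarrow> ('a::real_normed_vector, 'b) mlin"
  is "\<lambda>y xs. if xs = [] then y else 0"
  subgoal for y by (intro mlin_memI[where C = "norm y"]) (auto simp: linear_iff)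
  done

lemma mconst_in_W: "mconst y \<in> W 0"
  by (auto simp: W_def mconst.rep_eq)

lemma norm_mconst: "norm (mconst y :: ('a::real_normed_vector, 'b::real_normed_vector) mlin) = norm y"
proof (rule antisym)
  show "norm (mconst y :: ('a, 'b) mlin) \<le> norm y"
    by (rule norm_mlin_le) (simp add: mconst.rep_eq)
  show "norm y \<le> norm (mconst y :: ('a, 'b) mlin)"
    using norm_mapply[of "mconst y :: ('a, 'b) mlin" "[]"] by (simp add: mconst.rep_eq)
qed

text \<open>The identification of \<open>L(Z, W\<^sub>p)\<close> with \<open>W\<^sub>p\<^sub>+\<^sub>1\<close>; meaningful for bounded linear \<open>L\<close> only.\<close>

definition muncurry ::
    "('a \<Rightarrow> ('a::real_normed_vector, 'b::real_normed_vector) mlin) \<Rightarrow> ('a, 'b) mlin"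
  where "muncurry L = Mlin (\<lambda>xs. case xs of [] \<Rightarrow> 0 | h # hs \<Rightarrow> mapply (L h) hs)"

lemma mapply_muncurry:
  assumes "bounded_linear L"
  shows "mapply (muncurry L) xs = (case xs of [] \<Rightarrow> 0 | h # hs \<Rightarrow> mapply (L h) hs)"
proof -
  interpret L: bounded_linear L by fact
  let ?T = "\<lambda>xs. case xs of [] \<Rightarrow> 0 | h # hs \<Rightarrow> mapply (L h) hs"
  obtain K where K: "\<And>h. norm (L h) \<le> norm h * K" and K0: "0 \<le> K"
    using L.nonneg_bounded by blast
  have "linear (\<lambda>h. ?T (xs @ h # ys))" for xs ys
  proof (cases xs)
    case Nil
    then show ?thesis
      by (simp add: linear_iff L.add L.scaleR plus_mlin.rep_eq scaleR_mlin.rep_eq)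
  next
    case (Cons x xs')
    then show ?thesis using linear_mapply[of "L x" xs' ys] by simp
  qed
  moreover have "norm (?T xs) \<le> K" if xs: "\<And>x. x \<in> set xs \<Longrightarrow> norm x \<le> 1" for xs
  proof (cases xs)
    case (Cons h hs)
    have "norm (mapply (L h) hs) \<le> norm (L h)"
      using xs Cons by (intro norm_mapply_le_unit) auto
    also have "\<dots> \<le> norm h * K" by (rule K)
    also have "\<dots> \<le> 1 * K" using xs Cons K0 by (intro mult_right_mono) auto
    finally show ?thesis using Cons by simp
  qed (use K0 in simp)
  ultimately have "?T \<in> {T. (\<forall>xs ys. linear (\<lambda>h. T (xs @ h # ys))) \<and>
      bdd_above ((\<lambda>xs. norm (T xs)) ` {xs. \<forall>x\<in>set xs. norm x \<le> 1})}"
    unfolding mem_Collect_eq by (rule mlin_memI)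
  then show ?thesis unfolding muncurry_def by (simp add: Mlin_inverse)
qed

text \<open>\<open>diffl p f x\<close> is \<open>d\<^sup>pf(x)\<close>, with
  \<open>d\<^sup>p\<^sup>+\<^sup>1f(x)(h\<^sub>0,\<dots>,h\<^sub>p) = (D(d\<^sup>pf)(x) h\<^sub>0)(h\<^sub>1,\<dots>,h\<^sub>p)\<close>.\<close>

primrec diffl ::
    "nat \<Rightarrow> ('a \<Rightarrow> 'b) \<Rightarrow> 'a::real_normed_vector \<Rightarrow> ('a, 'b::real_normed_vector) mlin"
where
  "diffl 0 f x = mconst (f x)"
| "diffl (Suc p) f x = muncurry (frechet_derivative (diffl p f) (at x))"

definition Ck :: "'a set \<Rightarrow> nat \<Rightarrow> ('a::real_normed_vector \<Rightarrow> 'b::real_normed_vector) \<Rightarrow> bool"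
  where "Ck \<Omega> k f \<longleftrightarrow>
    (\<forall>p<k. \<forall>x\<in>\<Omega>. diffl p f differentiable (at x)) \<and> (\<forall>p\<le>k. continuous_on \<Omega> (diffl p f))"

lemma diffl_in_W:
  assumes "open \<Omega>" "Ck \<Omega> k f" "p \<le> k" "x \<in> \<Omega>"
  shows "diffl p f x \<in> W p"
  using assms(3,4)
proof (induction p arbitrary: x)
  case 0
  then show ?case by (simp add: mconst_in_W)
next
  case (Suc p)
  let ?L = "frechet_derivative (diffl p f) (at x)"
  have der: "(diffl p f has_derivative ?L) (at x)"
    using assms(2) Suc.prems by (auto simp: Ck_def frechet_derivative_works[symmetric])
  have "mapply (?L h) hs = 0" if "length hs \<noteq> p" for h hs
  proof -
    have 1: "((\<lambda>y. mapply (diffl p f y) hs) has_derivative (\<lambda>h. mapply (?L h) hs)) (at x)"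
      by (rule bounded_linear.has_derivative[OF bounded_linear_mapply der])
    have zero: "mapply (diffl p f y) hs = 0" if "y \<in> \<Omega>" for y
      using Suc.IH[OF _ that] Suc.prems \<open>length hs \<noteq> p\<close> by (auto simp: W_def)
    have "((\<lambda>y. mapply (diffl p f y) hs) has_derivative (\<lambda>h. 0)) (at x)"
      by (rule has_derivative_transform_within_open[OF has_derivative_const[of 0] assms(1) Suc.prems(2)])
        (simp add: zero)
    from has_derivative_unique[OF 1 this] show ?thesis by meson
  qed
  then show ?case
    using mapply_muncurry[OF has_derivative_bounded_linear[OF der]]
    by (auto simp: W_def split: list.split)
qed

text \<open>A function on \<open>\<Omega>\<close> is represented by its extension by \<open>0\<close>. As \<open>\<Omega>\<close> will be open, the
  values off \<open>\<Omega>\<close> do not affect the differentials on \<open>\<Omega>\<close>.\<close>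

definition BC :: "'a set \<Rightarrow> nat \<Rightarrow> ('a::real_normed_vector \<Rightarrow> 'b::real_normed_vector) set"
  where "BC \<Omega> k = {f. (\<forall>x. x \<notin> \<Omega> \<longrightarrow> f x = 0) \<and> Ck \<Omega> k f \<and> (\<forall>p\<le>k. bounded (diffl p f ` \<Omega>))}"

definition norm_BC :: "'a set \<Rightarrow> nat \<Rightarrow> ('a::real_normed_vector \<Rightarrow> 'b::real_normed_vector) \<Rightarrow> real"
  where "norm_BC \<Omega> k f = (MAX p\<in>{..k}. SUP x\<in>\<Omega>. norm (diffl p f x))"

definition dist_BC ::
    "'a set \<Rightarrow> nat \<Rightarrow> ('a::real_normed_vector \<Rightarrow> 'b::real_normed_vector) \<Rightarrow> ('a \<Rightarrow> 'b) \<Rightarrow> real"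
  where "dist_BC \<Omega> k f g = norm_BC \<Omega> k (\<lambda>x. f x - g x)"


section \<open>Measures of noncompactness\<close>

text \<open>The Kuratowski measure of \<open>S \<subseteq> X\<close> with respect to a metric \<open>d\<close> on \<open>X\<close>. That the diameter of
  \<open>A\<close> is at most \<open>\<epsilon>\<close> is written out, since a real-valued supremum says nothing for unbounded \<open>A\<close>.\<close>

definition kuratowski :: "'a set \<Rightarrow> ('a \<Rightarrow> 'a \<Rightarrow> real) \<Rightarrow> 'a set \<Rightarrow> real"
  where "kuratowski X d S =
    Inf {\<epsilon>. 0 < \<epsilon> \<and> (\<exists>\<A>. finite \<A> \<and> (\<forall>A\<in>\<A>. A \<subseteq> X \<and> (\<forall>a\<in>A. \<forall>b\<in>A. d a b \<le> \<epsilon>)) \<and> S \<subseteq> \<Union>\<A>)}"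

definition alpha :: "'a set \<Rightarrow> nat \<Rightarrow> ('a::real_normed_vector \<Rightarrow> 'b::real_normed_vector) set \<Rightarrow> real"
  where "alpha \<Omega> k M = kuratowski (BC \<Omega> k) (dist_BC \<Omega> k) M"

definition alpha_W :: "nat \<Rightarrow> ('a::real_normed_vector, 'b::real_normed_vector) mlin set \<Rightarrow> real"
  where "alpha_W p S = kuratowski (W p) dist S"

definition mu_alpha :: "'a set \<Rightarrow> nat \<Rightarrow> ('a::real_normed_vector \<Rightarrow> 'b::real_normed_vector) set \<Rightarrow> real"
  where "mu_alpha \<Omega> k M = (MAX p\<in>{..k}. SUP x\<in>\<Omega>. alpha_W p ((\<lambda>f. diffl p f x) ` M))"

text \<open>\<open>diffl p (f - \<phi>)\<close> is bounded on \<open>\<Omega>\<close> for \<open>f, \<phi>\<close> in \<open>BC \<Omega> k\<close>, so \<^const>\<open>diameter\<close> is the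
  true diameter here.\<close>

definition omega_BC :: "'a set \<Rightarrow> nat \<Rightarrow> ('a::real_normed_vector \<Rightarrow> 'b::real_normed_vector) set \<Rightarrow> real"
  where "omega_BC \<Omega> k M =
    Inf {\<epsilon>. 0 < \<epsilon> \<and> (\<exists>\<A> \<Phi>. finite \<A> \<and> partition_on \<Omega> \<A> \<and> finite \<Phi> \<and> \<Phi> \<subseteq> BC \<Omega> k \<and>
      (\<forall>f\<in>M. \<exists>\<phi>\<in>\<Phi>. \<forall>A\<in>\<A>.
        (MAX p\<in>{..k}. diameter (diffl p (\<lambda>x. f x - \<phi> x) ` A)) \<le> \<epsilon>))}"

end

theory Submission
  imports Defs
begin

text \<open>The lower bounds are direct: evaluating \<open>d\<^sup>p\<close> at a point maps a set of diameter at most \<open>\<epsilon>\<close> in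
  \<open>BC\<^sup>k\<close> to a set of diameter at most \<open>\<epsilon>\<close> in \<open>W\<^sub>p\<close>, and choosing one function \<open>\<phi>\<^sub>j\<close> in each set of a
  cover makes \<open>d\<^sup>p(f - \<phi>\<^sub>j)\<close> vary by at most \<open>2\<epsilon>\<close> on the whole of \<open>\<Omega>\<close>, so that the trivial partition
  will do. For the upper bound, pick a point \<open>x\<^sub>i\<close> in each cell of the partition and classify the
  functions \<open>f \<in> M\<close> by the index \<open>j\<close> and by the members of covers of the sets \<open>M\<^sup>p(x\<^sub>i)\<close> that contain
  \<open>d\<^sup>pf(x\<^sub>i)\<close>. There are finitely many classes, and for \<open>f, g\<close> in the same class and \<open>x\<close> in the cell of
  \<open>x\<^sub>i\<close> one splits \<open>d\<^sup>p(f - g)(x)\<close> into \<open>d\<^sup>p(f - g)(x\<^sub>i)\<close> and the two oscillations of \<open>d\<^sup>p(f - \<phi>\<^sub>j)\<close> and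
  \<open>d\<^sup>p(g - \<phi>\<^sub>j)\<close> between \<open>x\<close> and \<open>x\<^sub>i\<close>.\<close>

section \<open>Finite covers and the Kuratowski measure\<close>

definition finite_cover :: "'a set \<Rightarrow> ('a \<Rightarrow> 'a \<Rightarrow> real) \<Rightarrow> 'a set \<Rightarrow> real \<Rightarrow> 'a set set \<Rightarrow> bool"
  where "finite_cover X d S \<epsilon> \<A> \<longleftrightarrow>
    finite \<A> \<and> (\<forall>A\<in>\<A>. A \<subseteq> X \<and> (\<forall>a\<in>A. \<forall>b\<in>A. d a b \<le> \<epsilon>)) \<and> S \<subseteq> \<Union>\<A>"

lemma kuratowski_eq: "kuratowski X d S = Inf {\<epsilon>. 0 < \<epsilon> \<and> (\<exists>\<A>. finite_cover X d S \<epsilon> \<A>)}"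
  by (simp add: kuratowski_def finite_cover_def)

lemma kuratowski_le:
  assumes "0 < \<epsilon>" "finite_cover X d S \<epsilon> \<A>"
  shows "kuratowski X d S \<le> \<epsilon>"
  unfolding kuratowski_eq using assms by (intro cInf_lower) (auto intro!: bdd_belowI[of _ 0])

lemma finite_cover_singleton:
  assumes "S \<subseteq> X" "\<And>a b. a \<in> S \<Longrightarrow> b \<in> S \<Longrightarrow> d a b \<le> \<epsilon>"
  shows "finite_cover X d S \<epsilon> {S}"
  using assms by (simp add: finite_cover_def)

text \<open>An infimum of reals yields an element below \<open>\<delta>\<close> only if the set is
  nonempty. The bound \<open>C\<close> ensures this through the cover by \<open>S\<close> alone, and
  a cover for a smaller constant also serves for \<open>\<delta>\<close>.\<close>

lemma kuratowski_less_obtains_cover: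
  assumes "kuratowski X d S < \<delta>" "S \<subseteq> X" "\<And>a b. a \<in> S \<Longrightarrow> b \<in> S \<Longrightarrow> d a b \<le> C"
  obtains \<A> where "0 < \<delta>" "finite_cover X d S \<delta> \<A>"
proof -
  \<comment> \<open>Constants of covers must be positive, which \<open>C\<close> need not
    be.\<close>
  have "finite_cover X d S (max C 1) {S}"
    using assms(2,3) by (intro finite_cover_singleton) (auto intro: le_max_iff_disj[THEN iffD2])
  then have "{\<epsilon>. 0 < \<epsilon> \<and> (\<exists>\<A>. finite_cover X d S \<epsilon> \<A>)} \<noteq> {}"
    by (auto intro!: exI[of _ "max C 1"])
  from cInf_lessD[OF this assms(1)[unfolded kuratowski_eq]]
  obtain \<epsilon> \<A> where "0 < \<epsilon>" "finite_cover X d S \<epsilon> \<A>" "\<epsilon> < \<delta>"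
    by blast
  then have "0 < \<delta>" "finite_cover X d S \<delta> \<A>"
    unfolding finite_cover_def by (auto, meson less_imp_le order_trans)
  then show thesis by (rule that)
qed

section \<open>Differentials of differences and the norm of BC^k\<close>

lemma muncurry_diff:
  assumes "bounded_linear L" "bounded_linear L'"
  shows "muncurry (\<lambda>h. L h - L' h) = muncurry L - muncurry L'"
  using assms
  by (intro mlin_eqI)
    (simp add: mapply_muncurry bounded_linear_sub mapply_minus split: list.split)

lemma Ck_has_derivative:
  assumes "Ck \<Omega> k f" "p < k" "x \<in> \<Omega>"
  shows "(diffl p f has_derivative frechet_derivative (diffl p f) (at x)) (at x)"
  using assms by (auto simp: Ck_def frechet_derivative_works[symmetric])

text \<open>\<open>frechet_derivative\<close> is a choice, so its linearity comes from the
  uniqueness of the derivative, order by order.\<close>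

lemma diffl_diff:
  fixes f g :: "'a::real_normed_vector \<Rightarrow> 'b::real_normed_vector"
  assumes "open \<Omega>" "Ck \<Omega> k f" "Ck \<Omega> k g" "p \<le> k" "x \<in> \<Omega>"
  shows "diffl p (\<lambda>x. f x - g x) x = diffl p f x - diffl p g x"
  using assms(4,5)
proof (induction p arbitrary: x)
  case 0
  show ?case by (rule mlin_eqI) (simp add: mapply_minus mconst.rep_eq)
next
  case (Suc p)
  note D = Ck_has_derivative[OF assms(2), of p x] Ck_has_derivative[OF assms(3), of p x]
  have "((\<lambda>y. diffl p f y - diffl p g y) has_derivative
      (\<lambda>h. frechet_derivative (diffl p f) (at x) h - frechet_derivative (diffl p g) (at x) h)) (at x)"
    using D Suc.prems by (intro has_derivative_diff) auto
  \<comment> \<open>The induction hypothesis holds on all of the open set \<open>\<Omega>\<close>,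
    hence near \<open>x\<close>, so the derivative carries over.\<close>
  then have "(diffl p (\<lambda>x. f x - g x) has_derivative
      (\<lambda>h. frechet_derivative (diffl p f) (at x) h - frechet_derivative (diffl p g) (at x) h)) (at x)"
    by (rule has_derivative_transform_within_open[OF _ assms(1) Suc.prems(2)])
      (use Suc in simp)
  from frechet_derivative_at[OF this] show ?case
    using D Suc.prems by (simp add: muncurry_diff[symmetric] has_derivative_bounded_linear)
qed

text \<open>A real \<open>SUP\<close> or \<open>diameter\<close> is an upper bound only for bounded
  sets; this lemma licenses both for differences.\<close>

lemma bounded_diffl_diff:
  assumes "open \<Omega>" "f \<in> BC \<Omega> k" "g \<in> BC \<Omega> k" "p \<le> k"
  shows "bounded (diffl p (\<lambda>x. f x - g x) ` \<Omega>)"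
proof -
  have "bounded ((\<lambda>x. diffl p f x - diffl p g x) ` \<Omega>)"
    using assms by (intro bounded_minus_comp) (auto simp: BC_def)
  also have "(\<lambda>x. diffl p f x - diffl p g x) ` \<Omega> = diffl p (\<lambda>x. f x - g x) ` \<Omega>"
    using assms by (intro image_cong refl) (auto simp: BC_def diffl_diff)
  finally show ?thesis .
qed

lemma norm_diffl_le_norm_BC:
  assumes "bounded (diffl p f ` \<Omega>)" "p \<le> k" "x \<in> \<Omega>"
  shows "norm (diffl p f x) \<le> norm_BC \<Omega> k f"
proof -
  have "bdd_above ((\<lambda>x. norm (diffl p f x)) ` \<Omega>)"
    using assms(1) by (simp only: bdd_above_norm[symmetric] image_image)
  then have "norm (diffl p f x) \<le> (SUP x\<in>\<Omega>. norm (diffl p f x))"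
    using assms(3) by (rule cSUP_upper2) simp
  also have "\<dots> \<le> norm_BC \<Omega> k f"
    using assms(2) unfolding norm_BC_def by (intro Max_ge) auto
  finally show ?thesis .
qed

lemma norm_BC_le:
  assumes "\<Omega> \<noteq> {}" "\<And>p x. p \<le> k \<Longrightarrow> x \<in> \<Omega> \<Longrightarrow> norm (diffl p f x) \<le> C"
  shows "norm_BC \<Omega> k f \<le> C"
  using assms unfolding norm_BC_def by (auto intro!: Max.boundedI cSUP_least)

text \<open>That evaluation does not expand distances is what carries covers from BC^k over to
  \<open>W p\<close> with the same constant.\<close>

lemma dist_diffl_le:
  assumes "open \<Omega>" "f \<in> BC \<Omega> k" "g \<in> BC \<Omega> k" "p \<le> k" "x \<in> \<Omega>"
  shows "dist (diffl p f x) (diffl p g x) \<le> dist_BC \<Omega> k f g"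
  using norm_diffl_le_norm_BC[OF bounded_diffl_diff[OF assms(1-4)] assms(4,5)]
    diffl_diff[OF assms(1) _ _ assms(4,5), of f g] assms(2,3)
  by (simp add: dist_BC_def dist_norm BC_def)

lemma dist_BC_le:
  assumes "open \<Omega>" "\<Omega> \<noteq> {}" "f \<in> BC \<Omega> k" "g \<in> BC \<Omega> k"
    and "\<And>p x. p \<le> k \<Longrightarrow> x \<in> \<Omega> \<Longrightarrow> dist (diffl p f x) (diffl p g x) \<le> C"
  shows "dist_BC \<Omega> k f g \<le> C"
  using assms unfolding dist_BC_def
  by (intro norm_BC_le) (auto simp: diffl_diff BC_def dist_norm)

section \<open>Partitions with small oscillation, and the lower bounds\<close>

definition osc_cover ::
    "'a set \<Rightarrow> nat \<Rightarrow> ('a::real_normed_vector \<Rightarrow> 'b::real_normed_vector) set \<Rightarrow> real \<Rightarrow>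
      'a set set \<Rightarrow> ('a \<Rightarrow> 'b) set \<Rightarrow> bool"
  where "osc_cover \<Omega> k M \<epsilon> \<A> \<Phi> \<longleftrightarrow>
    finite \<A> \<and> partition_on \<Omega> \<A> \<and> finite \<Phi> \<and> \<Phi> \<subseteq> BC \<Omega> k \<and>
      (\<forall>f\<in>M. \<exists>\<phi>\<in>\<Phi>. \<forall>A\<in>\<A>.
        (MAX p\<in>{..k}. diameter (diffl p (\<lambda>x. f x - \<phi> x) ` A)) \<le> \<epsilon>)"

lemma omega_BC_eq: "omega_BC \<Omega> k M = Inf {\<epsilon>. 0 < \<epsilon> \<and> (\<exists>\<A> \<Phi>. osc_cover \<Omega> k M \<epsilon> \<A> \<Phi>)}"
  by (simp add: omega_BC_def osc_cover_def)

lemma omega_BC_le: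
  assumes "0 < \<epsilon>" "osc_cover \<Omega> k M \<epsilon> \<A> \<Phi>"
  shows "omega_BC \<Omega> k M \<le> \<epsilon>"
  unfolding omega_BC_eq using assms by (intro cInf_lower) (auto intro!: bdd_belowI[of _ 0])

text \<open>The factor 1/2 of the theorem originates here: a bound \<open>\<epsilon>\<close> on the
  norms of the values gives \<open>2 * \<epsilon>\<close> for their mutual distances.\<close>

lemma finite_cover_BC_imp_osc_cover:
  assumes "open \<Omega>" "\<Omega> \<noteq> {}" "finite_cover (BC \<Omega> k) (dist_BC \<Omega> k) M \<epsilon> \<A>"
  obtains \<Phi> where "osc_cover \<Omega> k M (2 * \<epsilon>) {\<Omega>} \<Phi>"
proof
  let ?c = "\<lambda>A. SOME \<phi>. \<phi> \<in> A"
  note \<A> = assms(3)[unfolded finite_cover_def]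
  have c: "?c A \<in> A" if "A \<noteq> {}" for A :: "('a \<Rightarrow> 'b) set"
    using that by (simp add: some_in_eq)
  \<comment> \<open>The empty set is removed because \<open>SOME\<close> would pick an arbitrary
    function there, possibly outside \<open>BC \<Omega> k\<close>.\<close>
  show "osc_cover \<Omega> k M (2 * \<epsilon>) {\<Omega>} (?c ` (\<A> - {{}}))"
    unfolding osc_cover_def
  proof (intro conjI ballI)
    show "?c ` (\<A> - {{}}) \<subseteq> BC \<Omega> k" using \<A> c by (intro image_subsetI) (metis DiffE insertI1 subsetD)
    fix f assume "f \<in> M"
    then obtain A where A: "A \<in> \<A>" "f \<in> A" using \<A> by blast
    then have cA: "?c A \<in> A" by (intro c) blast
    then have BC: "f \<in> BC \<Omega> k" "?c A \<in> BC \<Omega> k" and le: "dist_BC \<Omega> k f (?c A) \<le> \<epsilon>"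
      using A \<A> by (meson subsetD)+
    have "diameter (diffl p (\<lambda>x. f x - ?c A x) ` \<Omega>) \<le> 2 * \<epsilon>" if "p \<le> k" for p
    proof (rule diameter_le)
      have *: "norm (diffl p (\<lambda>x. f x - ?c A x) x) \<le> \<epsilon>" if "x \<in> \<Omega>" for x
        using norm_diffl_le_norm_BC[OF bounded_diffl_diff[OF assms(1) BC \<open>p \<le> k\<close>] \<open>p \<le> k\<close> that] le
        by (simp add: dist_BC_def)
      show "norm (a - b) \<le> 2 * \<epsilon>"
        if ab: "a \<in> diffl p (\<lambda>x. f x - ?c A x) ` \<Omega>" "b \<in> diffl p (\<lambda>x. f x - ?c A x) ` \<Omega>" for a b
      proof -
        have "norm a \<le> \<epsilon>" "norm b \<le> \<epsilon>" using ab * by auto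
        then show ?thesis using norm_triangle_ineq4[of a b] by linarith
      qed
    qed (use assms(2) in auto)
    then have "(MAX p\<in>{..k}. diameter (diffl p (\<lambda>x. f x - ?c A x) ` \<Omega>)) \<le> 2 * \<epsilon>"
      by (auto intro!: Max.boundedI)
    then show "\<exists>\<phi>\<in>?c ` (\<A> - {{}}). \<forall>A\<in>{\<Omega>}.
        (MAX p\<in>{..k}. diameter (diffl p (\<lambda>x. f x - \<phi> x) ` A)) \<le> 2 * \<epsilon>"
      using A by (intro bexI[of _ "?c A"]) auto
  qed (use \<A> assms(2) in \<open>auto simp: partition_on_def disjoint_def\<close>)
qed

lemma finite_cover_BC_imp_finite_cover_W:
  assumes "open \<Omega>" "finite_cover (BC \<Omega> k) (dist_BC \<Omega> k) M \<epsilon> \<A>" "p \<le> k" "x \<in> \<Omega>"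
  shows "finite_cover (W p) dist ((\<lambda>f. diffl p f x) ` M) \<epsilon> ((`) (\<lambda>f. diffl p f x) ` \<A>)"
proof -
  note \<A> = assms(2)[unfolded finite_cover_def]
  have "diffl p f x \<in> W p" if "f \<in> A" "A \<in> \<A>" for f A
    using diffl_in_W[OF assms(1) _ assms(3,4)] that \<A> by (auto simp: BC_def)
  moreover have "dist (diffl p f x) (diffl p g x) \<le> \<epsilon>" if "f \<in> A" "g \<in> A" "A \<in> \<A>" for f g A
    using dist_diffl_le[OF assms(1) _ _ assms(3,4), of f g] that \<A> by (blast intro: order_trans)
  ultimately show ?thesis
    using \<A> by (fastforce simp: finite_cover_def)
qed

section \<open>Combining covers at sample points with small oscillation\<close>

lemma dist_le_dist_plus_oscillations:
  fixes a b a' b' c c' :: "'a::real_normed_vector"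
  shows "dist a b \<le> dist a' b' + dist (a - c) (a' - c') + dist (b - c) (b' - c')"
proof -
  \<comment> \<open>Both oscillations are taken against the same \<open>c\<close> and
    \<open>c'\<close>, which therefore cancel.\<close>
  have "a - b = ((a' - b') + ((a - c) - (a' - c'))) - ((b - c) - (b' - c'))" by simp
  then have "dist a b \<le> norm ((a' - b') + ((a - c) - (a' - c'))) + dist (b - c) (b' - c')"
    unfolding dist_norm by (metis norm_triangle_ineq4)
  then show ?thesis
    using norm_triangle_ineq[of "a' - b'" "(a - c) - (a' - c')"] by (simp add: dist_norm)
qed

text \<open>The constant is one \<open>\<delta>\<close> for the values at the sample point of a
  cell, plus one \<open>\<epsilon>\<close> for each of the two functions compared.\<close>

lemma finite_cover_BC_combine:
  assumes "open \<Omega>" "\<Omega> \<noteq> {}" "M \<subseteq> BC \<Omega> k"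
    and osc: "osc_cover \<Omega> k M \<epsilon> \<A> \<Phi>"
    and cover: "\<And>p x. p \<le> k \<Longrightarrow> x \<in> \<Omega> \<Longrightarrow>
      finite_cover (W p) dist ((\<lambda>f. diffl p f x) ` M) \<delta> (\<C> p x)"
  obtains \<B> where "finite_cover (BC \<Omega> k) (dist_BC \<Omega> k) M (\<delta> + 2 * \<epsilon>) \<B>"
proof -
  note osc' = osc[unfolded osc_cover_def]
  \<comment> \<open>Cells of a partition are nonempty by definition, so each has a sample point
    \<open>pt A\<close>.\<close>
  have "\<forall>A\<in>\<A>. \<exists>x. x \<in> A"
    using partition_onD3[of \<Omega> \<A>] osc' by (metis ex_in_conv)
  then obtain pt where pt: "pt A \<in> A" if "A \<in> \<A>" for A by metis
  have sub: "A \<subseteq> \<Omega>" if "A \<in> \<A>" for A using osc' that by (auto simp: partition_on_def)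
  then have pt_\<Omega>: "pt A \<in> \<Omega>" if "A \<in> \<A>" for A using pt that by blast
  have "\<forall>f\<in>M. \<exists>\<phi>. \<phi> \<in> \<Phi> \<and>
      (\<forall>A\<in>\<A>. (MAX p\<in>{..k}. diameter (diffl p (\<lambda>x. f x - \<phi> x) ` A)) \<le> \<epsilon>)"
    using osc' by blast
  from bchoice[OF this] obtain \<phi> where "\<forall>f\<in>M. \<phi> f \<in> \<Phi> \<and>
      (\<forall>A\<in>\<A>. (MAX p\<in>{..k}. diameter (diffl p (\<lambda>x. f x - \<phi> f x) ` A)) \<le> \<epsilon>)"
    by blast
  then have \<phi>: "\<phi> f \<in> \<Phi>"
      "\<And>A. A \<in> \<A> \<Longrightarrow> (MAX p\<in>{..k}. diameter (diffl p (\<lambda>x. f x - \<phi> f x) ` A)) \<le> \<epsilon>"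
    if "f \<in> M" for f
    using that by auto
  have "\<exists>C. C \<in> \<C> p (pt A) \<and> diffl p f (pt A) \<in> C" if "f \<in> M" "A \<in> \<A>" "p \<le> k" for f A p
  proof -
    have "(\<lambda>f. diffl p f (pt A)) ` M \<subseteq> \<Union>(\<C> p (pt A))"
      using cover[OF that(3) pt_\<Omega>[OF that(2)]] by (simp add: finite_cover_def)
    then show ?thesis using that(1) by blast
  qed
  then obtain c where c: "c f A p \<in> \<C> p (pt A)" "diffl p f (pt A) \<in> c f A p"
    if "f \<in> M" "A \<in> \<A>" "p \<le> k" for f A p
    by metis
  \<comment> \<open>\<open>key f\<close> records the class of \<open>f\<close>. Restricting the
    second component to cells and orders up to \<open>k\<close> places it in a finite
    \<open>PiE\<close>, so only finitely many classes occur.\<close>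
  define key where "key f = (\<phi> f, \<lambda>q\<in>\<A> \<times> {..k}. c f (fst q) (snd q))" for f
  have "finite (\<Phi> \<times> PiE (\<A> \<times> {..k}) (\<lambda>q. \<C> (snd q) (pt (fst q))))"
    using osc' cover pt_\<Omega>
    by (intro finite_cartesian_product finite_PiE finite_SigmaI) (auto simp: finite_cover_def)
  moreover have "key ` M \<subseteq> \<Phi> \<times> PiE (\<A> \<times> {..k}) (\<lambda>q. \<C> (snd q) (pt (fst q)))"
    using \<phi>(1) c(1) unfolding key_def
    by (intro image_subsetI SigmaI) (auto simp: restrict_PiE_iff)
  ultimately have fin: "finite (key ` M)" by (rule finite_subset[rotated])
  have bound: "dist_BC \<Omega> k f g \<le> \<delta> + 2 * \<epsilon>" if fg: "f \<in> M" "g \<in> M" "key f = key g" for f g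
  proof (rule dist_BC_le[OF assms(1,2)])
    show "f \<in> BC \<Omega> k" "g \<in> BC \<Omega> k" using assms(3) fg by auto
    fix p x assume p: "p \<le> k" and x: "x \<in> \<Omega>"
    obtain A where A: "A \<in> \<A>" "x \<in> A" using osc' x by (auto simp: partition_on_def)
    define y where "y = pt A"
    have y: "y \<in> A" "y \<in> \<Omega>" using pt sub A by (auto simp: y_def)
    have "fst (key f) = fst (key g)" "snd (key f) (A, p) = snd (key g) (A, p)"
      using fg(3) by simp_all
    then have eq: "\<phi> f = \<phi> g" "c f A p = c g A p"
      using A p by (simp_all add: key_def)
    have osc_le: "dist (diffl p h x - diffl p (\<phi> h) x) (diffl p h y - diffl p (\<phi> h) y) \<le> \<epsilon>"
      if "h \<in> M" for h
    proof -
      let ?D = "diffl p (\<lambda>x. h x - \<phi> h x)"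
      have BC: "h \<in> BC \<Omega> k" "\<phi> h \<in> BC \<Omega> k" using that \<phi>(1) osc' assms(3) by auto
      have "bounded (?D ` A)"
        using bounded_diffl_diff[OF assms(1) BC p] sub[OF A(1)]
        by (auto intro: bounded_subset)
      then have "dist (?D x) (?D y) \<le> diameter (?D ` A)"
        using A y by (intro diameter_bounded_bound) auto
      also have "\<dots> \<le> (MAX p\<in>{..k}. diameter (diffl p (\<lambda>x. h x - \<phi> h x) ` A))"
        using p by (intro Max_ge) auto
      also have "\<dots> \<le> \<epsilon>" using \<phi>(2) that A by simp
      finally show ?thesis
        using diffl_diff[OF assms(1) _ _ p, of h "\<phi> h"] BC x y by (simp add: BC_def)
    qed
    have "dist (diffl p f y) (diffl p g y) \<le> \<delta>"
    proof -
      have "diffl p f y \<in> c f A p" "diffl p g y \<in> c f A p" "c f A p \<in> \<C> p y"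
        using c fg A p eq by (auto simp: y_def)
      then show ?thesis using cover[OF p y(2)] by (auto simp: finite_cover_def)
    qed
    moreover note osc_le[OF fg(1)] osc_le[OF fg(2)]
    ultimately show "dist (diffl p f x) (diffl p g x) \<le> \<delta> + 2 * \<epsilon>"
      using dist_le_dist_plus_oscillations[of "diffl p f x" "diffl p g x" "diffl p f y" "diffl p g y"
          "diffl p (\<phi> g) x" "diffl p (\<phi> g) y"]
      unfolding eq(1) by linarith
  qed
  \<comment> \<open>The covering sets are the fibres of \<open>key\<close> on
    \<open>M\<close>.\<close>
  have "finite_cover (BC \<Omega> k) (dist_BC \<Omega> k) M (\<delta> + 2 * \<epsilon>) ((\<lambda>q. {f \<in> M. key f = q}) ` key ` M)"
    using fin bound assms(3) by (auto simp: finite_cover_def)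
  then show thesis by (rule that)
qed

section \<open>The two-sided estimate\<close>

theorem theorem4p1:
  fixes \<Omega> :: "'z::banach set" and M :: "('z \<Rightarrow> 'y::banach) set" and k :: nat
  assumes "open \<Omega>" and "\<Omega> \<noteq> {}"
    and "M \<subseteq> BC \<Omega> k" and "M \<noteq> {}" and "\<exists>B. \<forall>f\<in>M. norm_BC \<Omega> k f \<le> B"
  shows "max (mu_alpha \<Omega> k M) (1/2 * omega_BC \<Omega> k M) \<le> alpha \<Omega> k M \<and>
    alpha \<Omega> k M \<le> mu_alpha \<Omega> k M + 2 * omega_BC \<Omega> k M"
proof -
  obtain B where B: "norm_BC \<Omega> k f \<le> B" if "f \<in> M" for f using assms(5) by blast
  have dist_W: "dist (diffl p f x) (diffl p g x) \<le> 2 * B"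
    if "p \<le> k" "x \<in> \<Omega>" "f \<in> M" "g \<in> M" for p x f g
  proof -
    have "norm (diffl p h x) \<le> B" if "h \<in> M" for h
      using norm_diffl_le_norm_BC[of p h \<Omega> k x] B[OF that] assms(3) that \<open>p \<le> k\<close> \<open>x \<in> \<Omega>\<close>
      by (force simp: BC_def)
    from this[OF that(3)] this[OF that(4)] show ?thesis
      using norm_triangle_ineq4[of "diffl p f x" "diffl p g x"] by (simp add: dist_norm)
  qed
  have dist_M: "dist_BC \<Omega> k f g \<le> 2 * B" if "f \<in> M" "g \<in> M" for f g
    using assms(1-3) dist_W that by (intro dist_BC_le) auto
  have in_W: "(\<lambda>f. diffl p f x) ` M \<subseteq> W p" if "p \<le> k" "x \<in> \<Omega>" for p x
    using diffl_in_W[OF assms(1) _ that] assms(3) by (auto simp: BC_def)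
  note alpha_cover = kuratowski_less_obtains_cover
    [where d = "dist_BC \<Omega> k", OF _ assms(3) dist_M, folded alpha_def]

  \<comment> \<open>The infimum defining \<open>alpha\<close> need not be attained, so both lower
    bounds are first shown with any larger \<open>\<delta>\<close> in its place;
    \<open>dense_ge\<close> removes the slack at the end.\<close>
  have mu_le: "mu_alpha \<Omega> k M \<le> \<delta>" and omega_le: "omega_BC \<Omega> k M \<le> 2 * \<delta>"
    if "alpha \<Omega> k M < \<delta>" for \<delta>
  proof -
    from alpha_cover[OF that] obtain \<A> where \<A>: "0 < \<delta>"
      "finite_cover (BC \<Omega> k) (dist_BC \<Omega> k) M \<delta> \<A>" by auto
    have "alpha_W p ((\<lambda>f. diffl p f x) ` M) \<le> \<delta>" if "p \<le> k" "x \<in> \<Omega>" for p x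
      using kuratowski_le[OF \<A>(1) finite_cover_BC_imp_finite_cover_W[OF assms(1) \<A>(2) that]]
      by (simp add: alpha_W_def)
    then show "mu_alpha \<Omega> k M \<le> \<delta>"
      unfolding mu_alpha_def using assms(2) by (auto intro!: Max.boundedI cSUP_least)
    show "omega_BC \<Omega> k M \<le> 2 * \<delta>"
      using finite_cover_BC_imp_osc_cover[OF assms(1,2) \<A>(2)] omega_BC_le[of "2 * \<delta>" \<Omega> k M] \<A>(1)
      by (metis mult_pos_pos zero_less_numeral)
  qed

  \<comment> \<open>Needed to extract witnesses from the infimum \<open>omega_BC\<close>. Any number
    above \<open>alpha\<close> has a cover, here \<open>alpha \<Omega> k M + 1\<close>, and that
    cover yields an element.\<close>
  have ne: "{\<epsilon>. 0 < \<epsilon> \<and> (\<exists>\<A> \<Phi>. osc_cover \<Omega> k M \<epsilon> \<A> \<Phi>)} \<noteq> {}"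
  proof -
    from alpha_cover[of "alpha \<Omega> k M + 1"] obtain \<A> where \<A>: "0 < alpha \<Omega> k M + 1"
      "finite_cover (BC \<Omega> k) (dist_BC \<Omega> k) M (alpha \<Omega> k M + 1) \<A>" by auto
    from finite_cover_BC_imp_osc_cover[OF assms(1,2) \<A>(2)] obtain \<Phi> where
      "osc_cover \<Omega> k M (2 * (alpha \<Omega> k M + 1)) {\<Omega>} \<Phi>" .
    with \<A>(1) have "2 * (alpha \<Omega> k M + 1) \<in> {\<epsilon>. 0 < \<epsilon> \<and> (\<exists>\<A> \<Phi>. osc_cover \<Omega> k M \<epsilon> \<A> \<Phi>)}"
      by (simp only: mem_Collect_eq) (intro conjI exI, simp)
    then show ?thesis by blast
  qed

  have alpha_W_le: "alpha_W p ((\<lambda>f. diffl p f x) ` M) \<le> mu_alpha \<Omega> k M" if "p \<le> k" "x \<in> \<Omega>" for p x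
  proof -
    \<comment> \<open>A bound independent of \<open>x\<close> makes the \<open>SUP\<close> in
      \<open>mu_alpha\<close> a true upper bound; the 1 keeps the constant positive.\<close>
    have "alpha_W p ((\<lambda>f. diffl p f x) ` M) \<le> max (2 * B) 1" if "x \<in> \<Omega>" for x
      unfolding alpha_W_def
    proof (rule kuratowski_le)
      show "finite_cover (W p) dist ((\<lambda>f. diffl p f x) ` M) (max (2 * B) 1) {(\<lambda>f. diffl p f x) ` M}"
        using in_W dist_W \<open>p \<le> k\<close> that by (intro finite_cover_singleton) (auto simp: le_max_iff_disj)
    qed simp
    then have "bdd_above ((\<lambda>x. alpha_W p ((\<lambda>f. diffl p f x) ` M)) ` \<Omega>)"
      by (rule bdd_aboveI2)
    then have "alpha_W p ((\<lambda>f. diffl p f x) ` M) \<le> (SUP x\<in>\<Omega>. alpha_W p ((\<lambda>f. diffl p f x) ` M))"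
      using that(2) by (rule cSUP_upper[rotated])
    also have "\<dots> \<le> mu_alpha \<Omega> k M"
      using that(1) unfolding mu_alpha_def by (intro Max_ge) auto
    finally show ?thesis .
  qed

  have alpha_le: "alpha \<Omega> k M \<le> \<delta> + 2 * \<epsilon>"
    if \<delta>: "mu_alpha \<Omega> k M < \<delta>" and \<epsilon>: "omega_BC \<Omega> k M < \<epsilon>" for \<delta> \<epsilon>
  proof -
    from cInf_lessD[OF ne \<epsilon>[unfolded omega_BC_eq]] obtain \<epsilon>' \<A> \<Phi>
      where e: "0 < \<epsilon>'" "\<epsilon>' < \<epsilon>" and osc: "osc_cover \<Omega> k M \<epsilon>' \<A> \<Phi>" by blast
    have cover: "0 < \<delta> \<and> (\<exists>\<C>. finite_cover (W p) dist ((\<lambda>f. diffl p f x) ` M) \<delta> \<C>)"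
      if "p \<le> k" "x \<in> \<Omega>" for p x
    proof -
      have "kuratowski (W p) dist ((\<lambda>f. diffl p f x) ` M) < \<delta>"
        using alpha_W_le[OF that] \<delta> by (simp add: alpha_W_def)
      then show ?thesis
        by (rule kuratowski_less_obtains_cover[OF _ in_W[OF that], where C = "2 * B"])
          (use dist_W that in auto)
    qed
    then obtain \<C> where \<C>: "finite_cover (W p) dist ((\<lambda>f. diffl p f x) ` M) \<delta> (\<C> p x)"
      if "p \<le> k" "x \<in> \<Omega>" for p x by metis
    \<comment> \<open>Constants of covers are positive, and the nonempty \<open>\<Omega>\<close>
      provides a point at which there is a cover.\<close>
    have "0 < \<delta>" using cover assms(2) by blast
    obtain \<B> where "finite_cover (BC \<Omega> k) (dist_BC \<Omega> k) M (\<delta> + 2 * \<epsilon>') \<B>"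
      using finite_cover_BC_combine[OF assms(1-3) osc \<C>] by blast
    then have "alpha \<Omega> k M \<le> \<delta> + 2 * \<epsilon>'"
      unfolding alpha_def using \<open>0 < \<delta>\<close> e by (intro kuratowski_le) auto
    with e show ?thesis by simp
  qed

  have "mu_alpha \<Omega> k M \<le> alpha \<Omega> k M"
    by (rule dense_ge) (rule mu_le)
  moreover have "1/2 * omega_BC \<Omega> k M \<le> alpha \<Omega> k M"
    by (rule dense_ge) (use omega_le in fastforce)
  moreover have "alpha \<Omega> k M \<le> mu_alpha \<Omega> k M + 2 * omega_BC \<Omega> k M"
  proof (rule field_le_epsilon)
    fix e :: real assume "0 < e"
    then show "alpha \<Omega> k M \<le> mu_alpha \<Omega> k M + 2 * omega_BC \<Omega> k M + e"
      \<comment> \<open>The slacks add up to \<open>e / 2 + 2 * (e / 4) = e\<close>.\<close>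
      using alpha_le[of "mu_alpha \<Omega> k M + e / 2" "omega_BC \<Omega> k M + e / 4"] by simp
  qed
  ultimately show ?thesis by simp
qed

end
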